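(* For $\gamma\in\mathbb{R}$ and $\nu\in[\nu_\ell,\nu_u]$, the scaled expected length of $K(\widehat\sigma_\varepsilon,\widehat\nu)$, conditional on $x$ (defined as the expected length of $K(\widehat\sigma_\varepsilon,\widehat\nu)$ divided by the expected length of $J_{c^*}(\widehat\sigma_\varepsilon)$, conditional on $x$), is equal to $$\frac{z_{1-\alpha/2}}{\Phi^{-1}\big((c^*+1)/2\big)}\;\frac{E\Big((\widehat\sigma_\varepsilon/\sigma_\varepsilon)\big(\widehat w^{1/2}\,\mathcal{I}(\mathcal{H})+\mathcal{I}(\mathcal{H}^c)\big)\,\Big|\,x\Big)}{E(\widehat\sigma_\varepsilon/\sigma_\varepsilon)},$$ where $\mathcal{H}=\{H(\widehat\sigma_\varepsilon,\widehat\nu)\le z_{1-\alpha_H/2}^2\}$, $\widehat w=q(\widehat\nu,T)/(q(\widehat\nu,T)+r(x))$, and $\mathcal{I}(\mathcal{A})$ is $1$ if the statement $\mathcal{A}$ is true and $0$ if it is false.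
   Context: Model. Let $x=(x_{11},\dots,x_{1T},\dots,x_{N1},\dots,x_{NT})$ be the observed values of a time-varying covariate; the analysis is conditional on $x$, so $x$ is treated as given. For $i=1,\dots,N$, $t=1,\dots,T$, $$y_{it}=a+b\,x_{it}+\xi\,\overline{x}_i+\eta_i+\varepsilon_{it},\qquad \overline{x}_i=T^{-1}\sum_{t=1}^T x_{it},$$ where the $\eta_i$'s and $\varepsilon_{it}$'s are unobserved and independent, the $\eta_i$'s are iid $N(0,\sigma_\eta^2)$ and the $\varepsilon_{it}$'s are iid $N(0,\sigma_\varepsilon^2)$. Put $\nu=\sigma_\eta^2/\sigma_\varepsilon^2\in(0,\infty)$ and $\gamma=\xi N^{1/2}/\sigma_\varepsilon\in\mathbb{R}$. Overbars with index $i$ denote averages over $t$ (e.g. $\overline{y}_i$), and overbars without index denote averages of these over $i$ (e.g. $\overline{x}=N^{-1}\sum_i\overline{x}_i$). Let $SSB=\sum_{i}(\overline{x}_i-\overline{x})^2$, $SSW=\sum_{i}\sum_{t}(x_{it}-\overline{x}_i)^2$, $r(x)=SSB/SSW$, and $q(n,T)=n+T^{-1}$. Estimators of slopes. $\widetilde b_W=\sum_i\sum_t(x_{it}-\overline{x}_i)(y_{it}-\overline{y}_i)/SSW$ and $\widetilde b_B=\sum_i(\overline{x}_i-\overline{x})(\overline{y}_i-\overline{y})/SSB$, with $\mathrm{Var}(\widetilde b_W\mid x)=\sigma_\varepsilon^2/SSW$ and $\mathrm{Var}(\widetilde b_B\mid x)=\sigma_\varepsilon^2 q(\nu,T)/SSB$.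 The estimator $\widehat b$ is the GLS estimator of $b$ in the model with $\xi=0$; explicitly $\widehat b=w\widetilde b_W+(1-w)\widetilde b_B$ with $w=q(\nu,T)/(q(\nu,T)+r(x))$, and $\mathrm{Var}(\widehat b\mid x)=\sigma_\varepsilon^2 w/SSW$. Estimators of variances. With $r_{it}=(y_{it}-\overline{y}_i)-\widetilde b_W(x_{it}-\overline{x}_i)$, $\widehat\sigma_\varepsilon^2=\frac{1}{N(T-1)}\sum_i\sum_t r_{it}^2$. With $\widetilde a=\overline{y}-\widetilde b_B\overline{x}$ and $\widetilde r_i=\overline{y}_i-(\widetilde a+\widetilde b_B\overline{x}_i)$, $\widehat\sigma_\eta^2=N^{-1}\sum_i\widetilde r_i^2-T^{-1}\widehat\sigma_\varepsilon^2$. Finally $\widehat\nu=\widehat\sigma_\eta^2/\widehat\sigma_\varepsilon^2$. Two-stage interval. Let $1-\alpha$ be the nominal coverage probability, $\alpha_H$ the nominal significance level of the Hausman pretest, and $z_c=\Phi^{-1}(c)$, with $\Phi$ the $N(0,1)$ cdf. Define $I(\sigma_\varepsilon,\nu)=[\widehat b\pm z_{1-\alpha/2}\mathrm{Var}(\widehat b\mid x)^{1/2}]$, $J(\sigma_\varepsilon)=[\widetilde b_W\pm z_{1-\alpha/2}\mathrm{Var}(\widetilde b_W\mid x)^{1/2}]$ and the Hausman statistic $H(\sigma_\varepsilon,\nu)=(\widetilde b_W-\widetilde b_B)^2/(\mathrm{Var}(\widetilde b_W\mid x)+\mathrm{Var}(\widetilde b_B\mid x))$. $K(\sigma_\varepsilon,\nu)$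 equals $I(\sigma_\varepsilon,\nu)$ if $H(\sigma_\varepsilon,\nu)\le z_{1-\alpha_H/2}^2$ and equals $J(\sigma_\varepsilon)$ otherwise. For $c\in[1/2,1)$ let $J_c(\sigma_\varepsilon)=[\widetilde b_W\pm\Phi^{-1}((c+1)/2)\mathrm{Var}(\widetilde b_W\mid x)^{1/2}]$. $I(\widehat\sigma_\varepsilon,\widehat\nu)$, $J(\widehat\sigma_\varepsilon)$, $J_c(\widehat\sigma_\varepsilon)$, $H(\widehat\sigma_\varepsilon,\widehat\nu)$, $K(\widehat\sigma_\varepsilon,\widehat\nu)$ are obtained by replacing $\sigma_\varepsilon,\nu$ everywhere in these definitions (including in the weight $w$ in $\widehat b$ and in the variance formulas) by $\widehat\sigma_\varepsilon,\widehat\nu$. Definition of $c^*$. For given $x,\alpha,\alpha_H$, the conditional coverage probability $P(b\in K(\widehat\sigma_\varepsilon,\widehat\nu)\mid x)$ is a function of $(\gamma,\nu)$ and is denoted $CP(\gamma,\nu)$; for any given $c$, the coverage probability $P(b\in J_c(\widehat\sigma_\varepsilon))$ does not depend on any unknown parameters. Let $[\nu_\ell,\nu_u]$ be the equi-tailed confidence interval for $\nu$ with coverage probability $1-\overline\alpha$ given by $\big[(\widehat\nu+T^{-1})/F_{1-\overline\alpha/2}-T^{-1},\,(\widehat\nu+T^{-1})/F_{\overline\alpha/2}-T^{-1}\big]$, where $F_p$ is the $p$-quantile of the distribution, conditional on $x$, of the pivotal quantity $(\widehat\nu+T^{-1})/(\nu+T^{-1})$. Then $c^*$ is defined to be the value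 of $c$ such that $P(b\in J_c(\widehat\sigma_\varepsilon))=\min_{n\in[\nu_\ell,\nu_u]}\min_{g}CP(g,n)$, where $g$ ranges over $\mathbb{R}$. *)

theory Defs
  imports "HOL-Probability.Probability"
begin

text \<open>
  A panel \<open>z\<close> assigns a real number \<open>z i t\<close> to unit \<open>i \<in> {1..N}\<close> and period \<open>t \<in> {1..T}\<close>;
  values outside this range are never used.  The covariate panel \<open>x\<close> is a fixed parameter
  throughout, which is how conditioning on \<open>x\<close> is rendered.
\<close>

type_synonym panel = "nat \<Rightarrow> nat \<Rightarrow> real"

definition unit_mean :: "nat \<Rightarrow> panel \<Rightarrow> nat \<Rightarrow> real" where
  "unit_mean T z i = (\<Sum>t=1..T. z i t) / real T"

definition grand_mean :: "nat \<Rightarrow> nat \<Rightarrow> panel \<Rightarrow> real" where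
  "grand_mean N T z = (\<Sum>i=1..N. unit_mean T z i) / real N"

definition SSB :: "nat \<Rightarrow> nat \<Rightarrow> panel \<Rightarrow> real" where
  "SSB N T x = (\<Sum>i=1..N. (unit_mean T x i - grand_mean N T x)\<^sup>2)"

definition SSW :: "nat \<Rightarrow> nat \<Rightarrow> panel \<Rightarrow> real" where
  "SSW N T x = (\<Sum>i=1..N. \<Sum>t=1..T. (x i t - unit_mean T x i)\<^sup>2)"

definition ratio :: "nat \<Rightarrow> nat \<Rightarrow> panel \<Rightarrow> real" where
  "ratio N T x = SSB N T x / SSW N T x"

definition q :: "real \<Rightarrow> nat \<Rightarrow> real" where
  "q n T = n + 1 / real T"

definition weight :: "nat \<Rightarrow> nat \<Rightarrow> panel \<Rightarrow> real \<Rightarrow> real" where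
  "weight N T x n = q n T / (q n T + ratio N T x)"

subsection \<open>Estimators\<close>

definition b_W :: "nat \<Rightarrow> nat \<Rightarrow> panel \<Rightarrow> panel \<Rightarrow> real" where
  "b_W N T x y =
     (\<Sum>i=1..N. \<Sum>t=1..T. (x i t - unit_mean T x i) * (y i t - unit_mean T y i)) / SSW N T x"

definition b_B :: "nat \<Rightarrow> nat \<Rightarrow> panel \<Rightarrow> panel \<Rightarrow> real" where
  "b_B N T x y =
     (\<Sum>i=1..N. (unit_mean T x i - grand_mean N T x) * (unit_mean T y i - grand_mean N T y))
       / SSB N T x"

definition b_GLS :: "nat \<Rightarrow> nat \<Rightarrow> panel \<Rightarrow> real \<Rightarrow> panel \<Rightarrow> real" where
  "b_GLS N T x n y = weight N T x n * b_W N T x y + (1 - weight N T x n) * b_B N T x y"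

text \<open>
  Conditional variances of the slope estimators as functions of the error standard deviation
  \<open>s\<close> and the variance ratio \<open>n\<close>.  They are functions rather than numbers because they are also
  evaluated at estimates of \<open>s\<close> and \<open>n\<close>.
\<close>

definition var_W :: "nat \<Rightarrow> nat \<Rightarrow> panel \<Rightarrow> real \<Rightarrow> real" where
  "var_W N T x s = s\<^sup>2 / SSW N T x"

definition var_B :: "nat \<Rightarrow> nat \<Rightarrow> panel \<Rightarrow> real \<Rightarrow> real \<Rightarrow> real" where
  "var_B N T x s n = s\<^sup>2 * q n T / SSB N T x"

definition var_GLS :: "nat \<Rightarrow> nat \<Rightarrow> panel \<Rightarrow> real \<Rightarrow> real \<Rightarrow> real" where
  "var_GLS N T x s n = s\<^sup>2 * weight N T x n / SSW N T x"

definition res_W :: "nat \<Rightarrow> nat \<Rightarrow> panel \<Rightarrow> panel \<Rightarrow> panel" where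
  "res_W N T x y i t =
     (y i t - unit_mean T y i) - b_W N T x y * (x i t - unit_mean T x i)"

definition sigma2_eps_hat :: "nat \<Rightarrow> nat \<Rightarrow> panel \<Rightarrow> panel \<Rightarrow> real" where
  "sigma2_eps_hat N T x y =
     (\<Sum>i=1..N. \<Sum>t=1..T. (res_W N T x y i t)\<^sup>2) / (real N * (real T - 1))"

definition sigma_eps_hat :: "nat \<Rightarrow> nat \<Rightarrow> panel \<Rightarrow> panel \<Rightarrow> real" where
  "sigma_eps_hat N T x y = sqrt (sigma2_eps_hat N T x y)"

definition a_tilde :: "nat \<Rightarrow> nat \<Rightarrow> panel \<Rightarrow> panel \<Rightarrow> real" where
  "a_tilde N T x y = grand_mean N T y - b_B N T x y * grand_mean N T x"

definition res_B :: "nat \<Rightarrow> nat \<Rightarrow> panel \<Rightarrow> panel \<Rightarrow> nat \<Rightarrow> real" where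
  "res_B N T x y i =
     unit_mean T y i - (a_tilde N T x y + b_B N T x y * unit_mean T x i)"

definition sigma2_eta_hat :: "nat \<Rightarrow> nat \<Rightarrow> panel \<Rightarrow> panel \<Rightarrow> real" where
  "sigma2_eta_hat N T x y =
     (\<Sum>i=1..N. (res_B N T x y i)\<^sup>2) / real N - sigma2_eps_hat N T x y / real T"

text \<open>
  This may be negative, but \<open>q\<close> evaluated at it never is.  Where \<open>sigma2_eps_hat\<close> vanishes (a null
  event of the model below whenever \<open>SSW > 0\<close>), division by zero gives the value 0.
\<close>

definition nu_hat :: "nat \<Rightarrow> nat \<Rightarrow> panel \<Rightarrow> panel \<Rightarrow> real" where
  "nu_hat N T x y = sigma2_eta_hat N T x y / sigma2_eps_hat N T x y"

subsection \<open>Confidence intervals\<close>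

definition quantile :: "real measure \<Rightarrow> real \<Rightarrow> real" where
  "quantile D p = Inf {u. p \<le> cdf D u}"

definition Phi_inv :: "real \<Rightarrow> real" where
  "Phi_inv p = quantile std_normal_distribution p"

definition conf_int :: "real \<Rightarrow> real \<Rightarrow> real set" where
  "conf_int m h = {m - h .. m + h}"

definition I_int :: "nat \<Rightarrow> nat \<Rightarrow> panel \<Rightarrow> real \<Rightarrow> real \<Rightarrow> real \<Rightarrow> panel \<Rightarrow> real set" where
  "I_int N T x \<alpha> s n y =
     conf_int (b_GLS N T x n y) (Phi_inv (1 - \<alpha> / 2) * sqrt (var_GLS N T x s n))"

definition J_int :: "nat \<Rightarrow> nat \<Rightarrow> panel \<Rightarrow> real \<Rightarrow> real \<Rightarrow> panel \<Rightarrow> real set" where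
  "J_int N T x \<alpha> s y =
     conf_int (b_W N T x y) (Phi_inv (1 - \<alpha> / 2) * sqrt (var_W N T x s))"

definition Jc_int :: "nat \<Rightarrow> nat \<Rightarrow> panel \<Rightarrow> real \<Rightarrow> real \<Rightarrow> panel \<Rightarrow> real set" where
  "Jc_int N T x c s y =
     conf_int (b_W N T x y) (Phi_inv ((c + 1) / 2) * sqrt (var_W N T x s))"

definition hausman :: "nat \<Rightarrow> nat \<Rightarrow> panel \<Rightarrow> real \<Rightarrow> real \<Rightarrow> panel \<Rightarrow> real" where
  "hausman N T x s n y =
     (b_W N T x y - b_B N T x y)\<^sup>2 / (var_W N T x s + var_B N T x s n)"

definition accepts :: "nat \<Rightarrow> nat \<Rightarrow> panel \<Rightarrow> real \<Rightarrow> real \<Rightarrow> real \<Rightarrow> panel \<Rightarrow> bool" where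
  "accepts N T x \<alpha>H s n y \<longleftrightarrow> hausman N T x s n y \<le> (Phi_inv (1 - \<alpha>H / 2))\<^sup>2"

definition K_int ::
    "nat \<Rightarrow> nat \<Rightarrow> panel \<Rightarrow> real \<Rightarrow> real \<Rightarrow> real \<Rightarrow> real \<Rightarrow> panel \<Rightarrow> real set" where
  "K_int N T x \<alpha> \<alpha>H s n y =
     (if accepts N T x \<alpha>H s n y then I_int N T x \<alpha> s n y else J_int N T x \<alpha> s y)"

definition Jc_hat :: "nat \<Rightarrow> nat \<Rightarrow> panel \<Rightarrow> real \<Rightarrow> panel \<Rightarrow> real set" where
  "Jc_hat N T x c y = Jc_int N T x c (sigma_eps_hat N T x y) y"

definition K_hat :: "nat \<Rightarrow> nat \<Rightarrow> panel \<Rightarrow> real \<Rightarrow> real \<Rightarrow> panel \<Rightarrow> real set" where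
  "K_hat N T x \<alpha> \<alpha>H y =
     K_int N T x \<alpha> \<alpha>H (sigma_eps_hat N T x y) (nu_hat N T x y) y"

definition accepts_hat :: "nat \<Rightarrow> nat \<Rightarrow> panel \<Rightarrow> real \<Rightarrow> panel \<Rightarrow> bool" where
  "accepts_hat N T x \<alpha>H y \<longleftrightarrow>
     accepts N T x \<alpha>H (sigma_eps_hat N T x y) (nu_hat N T x y) y"

subsection \<open>The model\<close>

definition response ::
    "nat \<Rightarrow> panel \<Rightarrow> real \<Rightarrow> real \<Rightarrow> real
      \<Rightarrow> (nat \<Rightarrow> 'w \<Rightarrow> real) \<Rightarrow> (nat \<Rightarrow> nat \<Rightarrow> 'w \<Rightarrow> real) \<Rightarrow> 'w \<Rightarrow> panel" where
  "response T x a b \<xi> \<eta> \<epsilon> \<omega> i t =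
     a + b * x i t + \<xi> * unit_mean T x i + \<eta> i \<omega> + \<epsilon> i t \<omega>"

definition error_index :: "nat \<Rightarrow> nat \<Rightarrow> (nat + nat \<times> nat) set" where
  "error_index N T = {1..N} <+> ({1..N} \<times> {1..T})"

definition error_model ::
    "'w measure \<Rightarrow> nat \<Rightarrow> nat \<Rightarrow> real \<Rightarrow> real
      \<Rightarrow> (nat \<Rightarrow> 'w \<Rightarrow> real) \<Rightarrow> (nat \<Rightarrow> nat \<Rightarrow> 'w \<Rightarrow> real) \<Rightarrow> bool" where
  "error_model M N T \<sigma>\<^sub>\<eta> \<sigma>\<^sub>\<epsilon> \<eta> \<epsilon> \<longleftrightarrow>
     prob_space M \<and>
     prob_space.indep_vars M (\<lambda>_. borel)
       (\<lambda>k. case k of Inl i \<Rightarrow> \<eta> i | Inr (i, t) \<Rightarrow> \<epsilon> i t) (error_index N T) \<and>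
     (\<forall>i\<in>{1..N}. distributed M lborel (\<eta> i) (normal_density 0 \<sigma>\<^sub>\<eta>)) \<and>
     (\<forall>i\<in>{1..N}. \<forall>t\<in>{1..T}. distributed M lborel (\<epsilon> i t) (normal_density 0 \<sigma>\<^sub>\<epsilon>))"

definition coverage ::
    "'w measure \<Rightarrow> real \<Rightarrow> (panel \<Rightarrow> real set) \<Rightarrow> ('w \<Rightarrow> panel) \<Rightarrow> real" where
  "coverage M b C Y = measure M {\<omega> \<in> space M. b \<in> C (Y \<omega>)}"

definition expected_length ::
    "'w measure \<Rightarrow> (panel \<Rightarrow> real set) \<Rightarrow> ('w \<Rightarrow> panel) \<Rightarrow> real" where
  "expected_length M C Y = (\<integral>\<omega>. measure lborel (C (Y \<omega>)) \<partial>M)"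

subsection \<open>The minimum coverage probability and \<open>c\<^sup>*\<close>\<close>

text \<open>
  Joint law of all errors.  It is used to evaluate coverage probabilities at parameter values
  other than the true ones.
\<close>

definition error_law ::
    "nat \<Rightarrow> nat \<Rightarrow> real \<Rightarrow> real \<Rightarrow> ((nat + nat \<times> nat) \<Rightarrow> real) measure" where
  "error_law N T \<sigma>\<^sub>\<eta> \<sigma>\<^sub>\<epsilon> =
     PiM (error_index N T)
       (\<lambda>k. density lborel
              (normal_density 0 (case k of Inl _ \<Rightarrow> \<sigma>\<^sub>\<eta> | Inr _ \<Rightarrow> \<sigma>\<^sub>\<epsilon>)))"

text \<open>
  Coverage probability of the two-stage interval when \<open>\<xi> N\<^sup>1\<^sup>/\<^sup>2 / \<sigma>\<^sub>\<epsilon> = g\<close> and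
  \<open>\<sigma>\<^sub>\<eta>\<^sup>2 / \<sigma>\<^sub>\<epsilon>\<^sup>2 = n > 0\<close>.  The remaining parameters \<open>a\<close>, \<open>b\<close>, \<open>\<sigma>\<^sub>\<epsilon>\<close> are explicit arguments here,
  although the value does not depend on them.
\<close>

definition CP ::
    "nat \<Rightarrow> nat \<Rightarrow> panel \<Rightarrow> real \<Rightarrow> real \<Rightarrow> real \<Rightarrow> real \<Rightarrow> real \<Rightarrow> real \<Rightarrow> real \<Rightarrow> real" where
  "CP N T x \<alpha> \<alpha>H a b \<sigma>\<^sub>\<epsilon> g n =
     coverage (error_law N T (\<sigma>\<^sub>\<epsilon> * sqrt n) \<sigma>\<^sub>\<epsilon>) b (K_hat N T x \<alpha> \<alpha>H)
       (response T x a b (g * \<sigma>\<^sub>\<epsilon> / sqrt (real N)) (\<lambda>i e. e (Inl i)) (\<lambda>i t e. e (Inr (i, t))))"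

definition pivot_law ::
    "'w measure \<Rightarrow> nat \<Rightarrow> nat \<Rightarrow> panel \<Rightarrow> real \<Rightarrow> ('w \<Rightarrow> panel) \<Rightarrow> real measure" where
  "pivot_law M N T x \<nu> Y =
     distr M borel (\<lambda>\<omega>. (nu_hat N T x (Y \<omega>) + 1 / real T) / (\<nu> + 1 / real T))"

definition nu_bound :: "real measure \<Rightarrow> nat \<Rightarrow> nat \<Rightarrow> panel \<Rightarrow> panel \<Rightarrow> real \<Rightarrow> real" where
  "nu_bound D N T x y p = (nu_hat N T x y + 1 / real T) / quantile D p - 1 / real T"

definition nu_int :: "real measure \<Rightarrow> nat \<Rightarrow> nat \<Rightarrow> panel \<Rightarrow> real \<Rightarrow> panel \<Rightarrow> real set" where
  "nu_int D N T x \<alpha>' y =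
     {nu_bound D N T x y (1 - \<alpha>' / 2) .. nu_bound D N T x y (\<alpha>' / 2)}"

text \<open>
  \<open>V\<close> is the realised confidence interval for the variance ratio.  Its lower end point can be
  negative, so it is intersected with the parameter space \<open>(0, \<infinity>)\<close> on which \<open>CP\<close> is meaningful.
  The minima are written as infima, which agree with them whenever they are attained.
\<close>

definition is_c_star ::
    "'w measure \<Rightarrow> nat \<Rightarrow> nat \<Rightarrow> panel \<Rightarrow> real \<Rightarrow> real \<Rightarrow> real \<Rightarrow> real \<Rightarrow> real
      \<Rightarrow> ('w \<Rightarrow> panel) \<Rightarrow> real set \<Rightarrow> real \<Rightarrow> bool" where
  "is_c_star M N T x \<alpha> \<alpha>H a b \<sigma>\<^sub>\<epsilon> Y V c \<longleftrightarrow>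
     c \<in> {1/2..<1} \<and>
     coverage M b (Jc_hat N T x c) Y =
       (INF n \<in> V \<inter> {0<..}. INF g. CP N T x \<alpha> \<alpha>H a b \<sigma>\<^sub>\<epsilon> g n)"

end

theory Submission
  imports Defs
begin

text \<open>
  Both intervals have half-lengths proportional to \<open>sigma_eps_hat / sqrt SSW\<close>, with non-negative
  factors because the normal quantiles at levels above 1/2 are non-negative and the estimated
  weight is never negative.  So the identity of the lengths holds pointwise, and the common
  constants cancel in the ratio of the integrals.
\<close>

text \<open>By symmetry the tails \<open>{..u}\<close> and \<open>{-u..}\<close> have equal mass.
  They are disjoint for \<open>u < 0\<close>, so twice that mass is at most 1.\<close>

lemma cdf_std_normal_le_half:
  assumes "u < 0"
  shows "cdf std_normal_distribution u \<le> 1 / 2"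
proof -
  interpret prob_space std_normal_distribution
    by (rule prob_space_normal_density) simp
  \<comment> \<open>Lebesgue measure is invariant under reflection and the density is even.\<close>
  have symm: "distr std_normal_distribution borel uminus = std_normal_distribution"
    by (subst lborel_distr_uminus[symmetric], subst density_distr)
      (simp_all add: normal_density_def lborel_distr_uminus)
  have "prob {..u} = measure (distr std_normal_distribution borel uminus) {..u}"
    by (simp only: symm)
  also have "\<dots> = prob (uminus -` {..u} \<inter> space std_normal_distribution)"
    by (rule measure_distr) auto
  also have "uminus -` {..u} \<inter> space std_normal_distribution = {-u..}"
    by auto
  finally have "prob {..u} = prob {-u..}" .
  moreover have "prob {..u} + prob {-u..} = prob ({..u} \<union> {-u..})"
    using assms by (intro finite_measure_Union[symmetric]) auto
  ultimately show ?thesis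
    using prob_le_1[of "{..u} \<union> {-u..}"] unfolding cdf_def by linarith
qed

text \<open>\<open>p > 1 / 2\<close> excludes every negative \<open>u\<close> from the set whose
  infimum is the quantile, and \<open>p < 1\<close> makes this set nonempty, so that 0 bounds its
  infimum from below.\<close>

lemma Phi_inv_nonneg:
  assumes "1 / 2 < p" "p < 1"
  shows "0 \<le> Phi_inv p"
proof -
  have "(cdf std_normal_distribution \<longlongrightarrow> 1) at_top"
    using real_dist_normal_dist
    by (rule real_distribution.cdf_lim_at_top_prob)
  then have "\<forall>\<^sub>F u in at_top. p < cdf std_normal_distribution u"
    using assms(2) by (rule order_tendstoD)
  then obtain u where "p \<le> cdf std_normal_distribution u"
    by (metis eventually_happens' trivial_limit_at_top_linorder less_imp_le)
  moreover have "0 \<le> u" if "p \<le> cdf std_normal_distribution u" for u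
    using cdf_std_normal_le_half[of u] that assms(1) by linarith
  ultimately show ?thesis
    unfolding Phi_inv_def quantile_def by (intro cInf_greatest) auto
qed

text \<open>For \<open>h < 0\<close> the interval is empty and has measure 0; this is why signs of
  quantiles and weights matter below.\<close>

lemma measure_conf_int: "0 \<le> h \<Longrightarrow> measure lborel (conf_int m h) = 2 * h"
  by (simp add: conf_int_def)

lemma sigma2_eps_hat_nonneg: "0 < T \<Longrightarrow> 0 \<le> sigma2_eps_hat N T x y"
  unfolding sigma2_eps_hat_def by (intro divide_nonneg_nonneg sum_nonneg mult_nonneg_nonneg) auto

text \<open>The term \<open>1 / real T\<close> added by \<open>q\<close> cancels the correction
  subtracted in \<open>sigma2_eta_hat\<close>, which leaves a quotient of sums of squares.\<close>

lemma q_nu_hat_nonneg: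
  assumes "0 < T"
  shows "0 \<le> q (nu_hat N T x y) T"
proof (cases "sigma2_eps_hat N T x y = 0")
  \<comment> \<open>Division by zero gives \<open>nu_hat = 0\<close>, so the value of
    \<open>q\<close> is \<open>1 / real T\<close>.\<close>
  case True
  then show ?thesis by (simp add: q_def nu_hat_def)
next
  case False
  then have "q (nu_hat N T x y) T
      = (\<Sum>i=1..N. (res_B N T x y i)\<^sup>2) / real N / sigma2_eps_hat N T x y"
    using assms by (simp add: q_def nu_hat_def sigma2_eta_hat_def field_simps)
  also have "\<dots> \<ge> 0"
    by (intro divide_nonneg_nonneg sum_nonneg sigma2_eps_hat_nonneg assms) auto
  finally show ?thesis .
qed

lemma weight_nu_hat_nonneg:
  assumes "0 < T" "0 \<le> ratio N T x"
  shows "0 \<le> weight N T x (nu_hat N T x y)"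
  using q_nu_hat_nonneg[OF assms(1)] assms(2) by (simp add: weight_def)

text \<open>\<open>var_GLS\<close> is \<open>var_W\<close> times the weight, so the two branches
  differ only by the factor \<open>sqrt (weight ...)\<close>; the indicators merge them into one
  integrand.\<close>

lemma measure_K_hat:
  assumes "0 < T" "0 \<le> ratio N T x" "0 \<le> SSW N T x" "0 \<le> Phi_inv (1 - \<alpha> / 2)"
  shows "measure lborel (K_hat N T x \<alpha> \<alpha>H y) =
    2 * Phi_inv (1 - \<alpha> / 2) / sqrt (SSW N T x) *
      (sigma_eps_hat N T x y *
        (sqrt (weight N T x (nu_hat N T x y)) * of_bool (accepts_hat N T x \<alpha>H y)
          + of_bool (\<not> accepts_hat N T x \<alpha>H y)))"
  using assms sigma2_eps_hat_nonneg[OF assms(1)] weight_nu_hat_nonneg[OF assms(1,2)]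
  by (simp add: K_hat_def K_int_def accepts_hat_def I_int_def J_int_def measure_conf_int
      var_GLS_def var_W_def sigma_eps_hat_def real_sqrt_mult real_sqrt_divide)

lemma measure_Jc_hat:
  assumes "0 < T" "0 \<le> SSW N T x" "0 \<le> Phi_inv ((c + 1) / 2)"
  shows "measure lborel (Jc_hat N T x c y) =
    2 * Phi_inv ((c + 1) / 2) / sqrt (SSW N T x) * sigma_eps_hat N T x y"
  using assms sigma2_eps_hat_nonneg[OF assms(1)]
  by (simp add: Jc_hat_def Jc_int_def measure_conf_int var_W_def sigma_eps_hat_def real_sqrt_divide)

theorem theorem4:
  fixes M :: "'w measure"
    and N T :: nat
    and x y\<^sub>o\<^sub>b\<^sub>s :: panel
    and \<eta> :: "nat \<Rightarrow> 'w \<Rightarrow> real" and \<epsilon> :: "nat \<Rightarrow> nat \<Rightarrow> 'w \<Rightarrow> real"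
    and Y :: "'w \<Rightarrow> panel"
    and a b \<xi> \<sigma>\<^sub>\<eta> \<sigma>\<^sub>\<epsilon> \<gamma> \<nu> \<alpha> \<alpha>H \<alpha>' c_star :: real
  assumes "SSW N T x > 0" and "SSB N T x > 0"
    and "\<sigma>\<^sub>\<eta> > 0" and "\<sigma>\<^sub>\<epsilon> > 0"
    and "error_model M N T \<sigma>\<^sub>\<eta> \<sigma>\<^sub>\<epsilon> \<eta> \<epsilon>"
    and "Y = response T x a b \<xi> \<eta> \<epsilon>"
    and "\<gamma> = \<xi> * sqrt (real N) / \<sigma>\<^sub>\<epsilon>" and "\<nu> = \<sigma>\<^sub>\<eta>\<^sup>2 / \<sigma>\<^sub>\<epsilon>\<^sup>2"
    and "0 < \<alpha>" "\<alpha> < 1" and "0 < \<alpha>H" "\<alpha>H < 1" and "0 < \<alpha>'" "\<alpha>' < 1"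
    and "\<nu> \<in> nu_int (pivot_law M N T x \<nu> Y) N T x \<alpha>' y\<^sub>o\<^sub>b\<^sub>s"
    and "is_c_star M N T x \<alpha> \<alpha>H a b \<sigma>\<^sub>\<epsilon> Y
           (nu_int (pivot_law M N T x \<nu> Y) N T x \<alpha>' y\<^sub>o\<^sub>b\<^sub>s) c_star"
  shows "expected_length M (K_hat N T x \<alpha> \<alpha>H) Y / expected_length M (Jc_hat N T x c_star) Y =
     Phi_inv (1 - \<alpha> / 2) / Phi_inv ((c_star + 1) / 2) *
     ((\<integral>\<omega>. sigma_eps_hat N T x (Y \<omega>) / \<sigma>\<^sub>\<epsilon> *
            (sqrt (weight N T x (nu_hat N T x (Y \<omega>))) * of_bool (accepts_hat N T x \<alpha>H (Y \<omega>))
              + of_bool (\<not> accepts_hat N T x \<alpha>H (Y \<omega>))) \<partial>M)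
       / (\<integral>\<omega>. sigma_eps_hat N T x (Y \<omega>) / \<sigma>\<^sub>\<epsilon> \<partial>M))"
proof -
  \<comment> \<open>For \<open>T = 0\<close> the inner sums of \<open>SSW\<close> would be
    empty.\<close>
  have T: "0 < T"
    using assms(1) by (cases T) (auto simp: SSW_def)
  have r: "0 \<le> ratio N T x" and W: "0 \<le> SSW N T x"
    using assms(1,2) by (simp_all add: ratio_def)
  have z: "0 \<le> Phi_inv (1 - \<alpha> / 2)"
    using assms(9,10) by (intro Phi_inv_nonneg) auto
  \<comment> \<open>\<open>c_star\<close> lies in \<open>{1/2..<1}\<close>, so the level lies in
    \<open>{3/4..<1}\<close>.\<close>
  have zc: "0 \<le> Phi_inv ((c_star + 1) / 2)"
    using assms(16) by (intro Phi_inv_nonneg) (auto simp: is_c_star_def)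
  show ?thesis
    \<comment> \<open>Constants leave the Bochner integral unconditionally, then
      \<open>2 / sqrt SSW\<close> and \<open>\<sigma>\<^sub>\<epsilon>\<close> cancel. Should a
      remaining denominator vanish, both sides are 0.\<close>
    using assms(1,4)
    by (simp add: expected_length_def measure_K_hat[OF T r W z] measure_Jc_hat[OF T W zc])
qed

end
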